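(* Let $F^{*}$ be the class of all entire functions of the form $\alpha(z)e^{P(z)}-k$, where $\alpha$ is a non-zero polynomial, $P$ is a non-constant polynomial, and $k\in\mathbb{C}\setminus\{0\}$ (with $\alpha$, $P$, $k$ depending on the function). Let $f,g\in F^{*}$ and let $a(z)$ be a non-zero polynomial. Then at least one of the two functions $f(z)g'(z)-a(z)$ and $g(z)f'(z)-a(z)$ has infinitely many zeros.
   Context: All polynomials are polynomials in one complex variable $z$ with complex coefficients; "non-zero polynomial" means not identically zero. *)

theory Defs
  imports "HOL-Complex_Analysis.Complex_Analysis" "HOL-Computational_Algebra.Polynomial"
begin

text \<open>Every function of the form below is automatically entire, so this need not be required
  separately.\<close>

definition Fstar :: "(complex \<Rightarrow> complex) set" where
  "Fstar = {f. \<exists>(\<alpha>::complex poly) (P::complex poly) (k::complex).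
      \<alpha> \<noteq> 0 \<and> degree P > 0 \<and> k \<noteq> 0 \<and>
      f = (\<lambda>z. poly \<alpha> z * exp (poly P z) - k)}"

end

theory Submission
  imports Defs
begin

text \<open>
  If the two functions had only finitely many zeros, they would be of the form $R e^S$ with
  polynomials $R$ and $S$ (they have finite order). Writing $f = \alpha e^P - k$,
  $g = \beta e^Q - l$, $f' = A e^P$ and $g' = B e^Q$, the first function is
  $\alpha B e^{P+Q} - k B e^Q - a$. By linear independence of exponentials of polynomials
  over the polynomials, exactly one of its exponentials survives, which forces $P + Q$ to be a
  constant $c$ and $e^c \alpha B = a$. Symmetrically $e^c \beta A = a$, so
  $\alpha B = \beta A$, i.e. $\alpha \beta' - \beta \alpha' = 2 \alpha \beta P'$, which is
  impossible by comparing degrees.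
\<close>

section \<open>Linear independence of exponentials of polynomials\<close>

text \<open>The action of differentiation on the coefficient of \<open>R * exp Q\<close>. The
  exponent comes first so that \<open>exp_deriv Q\<close> can be iterated with
  \<open>^^\<close>.\<close>

definition exp_deriv :: "complex poly \<Rightarrow> complex poly \<Rightarrow> complex poly" where
  "exp_deriv Q R = pderiv R + R * pderiv Q"

lemma has_field_derivative_poly_exp:
  "((\<lambda>z. poly R z * exp (poly Q z)) has_field_derivative
      poly (exp_deriv Q R) z * exp (poly Q z)) (at z)"
  by (auto intro!: derivative_eq_intros poly_DERIV simp: exp_deriv_def algebra_simps)

text \<open>If R' = -R Q' with R and Q' non-zero, then R' has degree at least that of R. So R is
  constant and R' = 0, although R Q' is not zero.\<close>

lemma exp_deriv_eq_0_iff: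
  assumes "degree Q > 0"
  shows "exp_deriv Q R = 0 \<longleftrightarrow> R = 0"
proof
  assume *: "exp_deriv Q R = 0"
  show "R = 0"
  proof (rule ccontr)
    assume R: "R \<noteq> 0"
    have Q: "pderiv Q \<noteq> 0" using assms by (simp add: pderiv_eq_0_iff)
    have eq: "pderiv R = - (R * pderiv Q)" using * by (simp add: exp_deriv_def add_eq_0_iff)
    hence nz: "pderiv R \<noteq> 0" using R Q by simp
    have "degree R \<le> degree (pderiv R)"
      using R Q by (simp add: eq degree_mult_eq)
    moreover have "degree (pderiv R) = degree R - 1" by (rule degree_pderiv)
    ultimately have "degree R = 0" by linarith
    with nz show False by (simp add: pderiv_eq_0_iff)
  qed
qed (simp add: exp_deriv_def)

lemma exp_deriv_funpow_eq_0_iff: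
  assumes "degree Q > 0"
  shows "(exp_deriv Q ^^ n) R = 0 \<longleftrightarrow> R = 0"
  by (induction n) (simp_all add: exp_deriv_eq_0_iff[OF assms])

lemma pderiv_funpow_Suc_degree: "(pderiv ^^ Suc (degree R)) R = (0 :: complex poly)"
proof (induction "degree R" arbitrary: R)
  case 0
  thus ?case by (simp add: pderiv_eq_0_iff)
next
  case (Suc n)
  hence "degree (pderiv R) = n" by (simp add: degree_pderiv)
  with Suc show ?case by (metis funpow_Suc_right o_apply)
qed

text \<open>Multiplying the relation by exp(-P j) turns the j-th term into the polynomial
  \<open>R j\<close>, which enough differentiations annihilate. They leave a shorter relation with
  exponents P i - P j, whose pairwise differences are the old ones. The induction hypothesis kills
  its coefficients, and \<open>exp_deriv\<close> is injective at zero for non-constant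
  exponents.\<close>

lemma exp_poly_independent:
  assumes "finite I"
    and "\<And>i j. i \<in> I \<Longrightarrow> j \<in> I \<Longrightarrow> i \<noteq> j \<Longrightarrow> degree (P i - P j :: complex poly) > 0"
    and "\<And>z. (\<Sum>i\<in>I. poly (R i) z * exp (poly (P i) z)) = 0"
    and "i \<in> I"
  shows "R i = 0"
  using assms
proof (induction I arbitrary: i R P rule: finite_induct)
  case empty
  thus ?case by simp
next
  case (insert j I)
  define Q where "Q = (\<lambda>i. P i - P j)"
  have degQ: "degree (Q i) > 0" if "i \<in> I" for i
    unfolding Q_def using insert.hyps that by (intro insert.prems(1)) auto
  have base: "(\<Sum>i\<in>I. poly (R i) z * exp (poly (Q i) z)) = - poly (R j) z" for z
  proof -
    have "0 = (\<Sum>i\<in>insert j I. poly (R i) z * exp (poly (P i) z)) * exp (- poly (P j) z)"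
      using insert.prems(2) by simp
    also have "\<dots> = (\<Sum>i\<in>insert j I. poly (R i) z * exp (poly (Q i) z))"
      by (simp add: sum_distrib_right Q_def exp_diff exp_minus divide_inverse mult.assoc del: sum.insert)
    also have "\<dots> = poly (R j) z + (\<Sum>i\<in>I. poly (R i) z * exp (poly (Q i) z))"
      using insert.hyps by (simp add: Q_def)
    finally show ?thesis by (simp add: eq_neg_iff_add_eq_0 add.commute)
  qed
  have iter: "(\<Sum>i\<in>I. poly ((exp_deriv (Q i) ^^ n) (R i)) z * exp (poly (Q i) z)) =
      - poly ((pderiv ^^ n) (R j)) z" for n z
  proof (induction n arbitrary: z)
    case 0
    show ?case using base by simp
  next
    case (Suc n)
    have "((\<lambda>z. \<Sum>i\<in>I. poly ((exp_deriv (Q i) ^^ n) (R i)) z * exp (poly (Q i) z))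
        has_field_derivative
        (\<Sum>i\<in>I. poly (exp_deriv (Q i) ((exp_deriv (Q i) ^^ n) (R i))) z * exp (poly (Q i) z))) (at z)"
      by (intro DERIV_sum has_field_derivative_poly_exp)
    moreover have "((\<lambda>z. - poly ((pderiv ^^ n) (R j)) z) has_field_derivative
        - poly (pderiv ((pderiv ^^ n) (R j))) z) (at z)"
      by (intro DERIV_minus poly_DERIV)
    ultimately show ?case
      unfolding Suc.IH by (auto dest: DERIV_unique)
  qed
  have RI: "R i = 0" if "i \<in> I" for i
  proof -
    have "(exp_deriv (Q i) ^^ Suc (degree (R j))) (R i) = 0"
    proof (rule insert.IH[where P = Q])
      show "degree (Q i - Q k) > 0" if "i \<in> I" "k \<in> I" "i \<noteq> k" for i k
        using insert.prems(1)[of i k] that by (simp add: Q_def)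
      show "(\<Sum>i\<in>I. poly ((exp_deriv (Q i) ^^ Suc (degree (R j))) (R i)) z * exp (poly (Q i) z)) = 0"
        for z
        unfolding iter pderiv_funpow_Suc_degree by simp
    qed fact
    thus ?thesis using exp_deriv_funpow_eq_0_iff[OF degQ[OF that]] by blast
  qed
  hence "poly (R j) z = 0" for z
    using base[of z] by simp
  hence "R j = 0" using poly_all_0_iff_0 by blast
  with RI insert.prems(3) show ?case by auto
qed

text \<open>Move T e^S to the left and apply independence. Either S agrees with some
  \<open>P m\<close> up to a constant, and only the m-th coefficient is altered, or S is a genuinely
  new exponent and every \<open>R i\<close> vanishes.\<close>

lemma exp_poly_sum_eq_single:
  fixes P R :: "'i \<Rightarrow> complex poly" and S T :: "complex poly"
  assumes "finite I"
    and P: "\<And>i j. i \<in> I \<Longrightarrow> j \<in> I \<Longrightarrow> i \<noteq> j \<Longrightarrow> degree (P i - P j) > 0"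
    and eq: "\<And>z. (\<Sum>i\<in>I. poly (R i) z * exp (poly (P i) z)) = poly T z * exp (poly S z)"
    and ij: "i \<in> I" "j \<in> I" "i \<noteq> j"
  shows "R i = 0 \<or> R j = 0"
proof (cases "\<exists>m\<in>I. degree (P m - S) = 0")
  case True
  then obtain m where m: "m \<in> I" "degree (P m - S) = 0" by blast
  then obtain c where c: "P m - S = [:c:]" by (meson degree_eq_zeroE)
  define R' where "R' = (\<lambda>i. if i = m then R m - smult (exp (- c)) T else R i)"
  have expS: "exp (poly S z) = exp (- c) * exp (poly (P m) z)" for z
  proof -
    have "S = P m - [:c:]" using c by (simp add: algebra_simps)
    thus ?thesis by (simp flip: exp_add)
  qed
  have "(\<Sum>i\<in>I. poly (R' i) z * exp (poly (P i) z)) = 0" for z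
  proof -
    have "(\<Sum>i\<in>I. poly (R' i) z * exp (poly (P i) z)) =
        (\<Sum>i\<in>I. poly (R i) z * exp (poly (P i) z) -
          (if i = m then poly T z * exp (poly S z) else 0))"
      by (intro sum.cong refl) (auto simp: R'_def expS algebra_simps)
    also have "\<dots> = 0"
      using m assms(1) by (simp add: sum_subtractf eq)
    finally show ?thesis .
  qed
  hence "R' n = 0" if "n \<in> I" for n
    using exp_poly_independent[where I = I and P = P and R = R'] assms(1) P that by blast
  \<comment> \<open>At least one of i and j differs from m, and there \<open>R'\<close> is still
    \<open>R\<close>.\<close>
  from this[OF ij(1)] this[OF ij(2)] ij(3) show ?thesis
    by (auto simp: R'_def split: if_splits)
next
  case False
  hence S: "degree (P m - S) > 0" if "m \<in> I" for m using that by fastforce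
  have S': "degree (S - P m) > 0" if "m \<in> I" for m
    using S[OF that] degree_minus[of "P m - S"] by simp
  \<comment> \<open>The index \<open>None\<close> is added for the new exponent S, with coefficient
    -T.\<close>
  define P' where "P' = case_option S P"
  define R' where "R' = case_option (- T) R"
  have "R' (Some i) = 0"
  proof (rule exp_poly_independent[where P = P' and R = R'])
    show "finite (insert None (Some ` I))" using assms(1) by simp
    show "degree (P' m - P' n) > 0"
      if "m \<in> insert None (Some ` I)" "n \<in> insert None (Some ` I)" "m \<noteq> n" for m n
      using that by (elim insertE imageE) (simp_all add: P'_def S S' P)
    show "(\<Sum>m\<in>insert None (Some ` I). poly (R' m) z * exp (poly (P' m) z)) = 0" for z
      using assms(1) by (simp add: sum.reindex R'_def P'_def eq)
  qed (use ij in simp)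
  thus ?thesis by (simp add: R'_def)
qed

section \<open>Functions of finite order\<close>

text \<open>With the base 1 + |z| instead of |z|, one bound serves the whole plane, and since the
  base is at least 1, exponents n may be enlarged freely.\<close>

definition finite_order :: "(complex \<Rightarrow> complex) \<Rightarrow> bool" where
  "finite_order f \<longleftrightarrow> (\<exists>C n. \<forall>z. norm (f z) \<le> exp (C * (1 + norm z) ^ n))"

lemma finite_orderE:
  assumes "finite_order f"
  obtains C n where "C \<ge> 0" "\<And>z. norm (f z) \<le> exp (C * (1 + norm z) ^ n)"
proof -
  from assms obtain C n where "norm (f z) \<le> exp (C * (1 + norm z) ^ n)" for z
    unfolding finite_order_def by blast
  moreover have "exp (C * (1 + norm z) ^ n) \<le> exp (\<bar>C\<bar> * (1 + norm z) ^ n)" for z :: complex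
    by (simp add: mult_right_mono)
  ultimately show ?thesis using that[of "\<bar>C\<bar>" n] order_trans by (metis abs_ge_zero)
qed

lemma finite_order_mult:
  assumes "finite_order f" "finite_order g"
  shows "finite_order (\<lambda>z. f z * g z)"
proof -
  obtain C n where C: "C \<ge> 0" "\<And>z. norm (f z) \<le> exp (C * (1 + norm z) ^ n)"
    using assms(1) by (rule finite_orderE) blast
  obtain D m where D: "D \<ge> 0" "\<And>z. norm (g z) \<le> exp (D * (1 + norm z) ^ m)"
    using assms(2) by (rule finite_orderE) blast
  have "norm (f z * g z) \<le> exp ((C + D) * (1 + norm z) ^ (n + m))" for z
  proof -
    have "norm (f z * g z) \<le> exp (C * (1 + norm z) ^ n) * exp (D * (1 + norm z) ^ m)"
      unfolding norm_mult using C(2) D(2) by (intro mult_mono) auto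
    also have "\<dots> = exp (C * (1 + norm z) ^ n + D * (1 + norm z) ^ m)"
      by (simp add: exp_add)
    also have "\<dots> \<le> exp ((C + D) * (1 + norm z) ^ (n + m))"
      unfolding exp_le_cancel_iff distrib_right using C(1) D(1)
      by (intro add_mono mult_left_mono power_increasing) auto
    finally show ?thesis .
  qed
  thus ?thesis unfolding finite_order_def by blast
qed

lemma finite_order_add:
  assumes "finite_order f" "finite_order g"
  shows "finite_order (\<lambda>z. f z + g z)"
proof -
  obtain C n where C: "C \<ge> 0" "\<And>z. norm (f z) \<le> exp (C * (1 + norm z) ^ n)"
    using assms(1) by (rule finite_orderE) blast
  obtain D m where D: "D \<ge> 0" "\<And>z. norm (g z) \<le> exp (D * (1 + norm z) ^ m)"
    using assms(2) by (rule finite_orderE) blast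
  have "norm (f z + g z) \<le> exp ((1 + C + D) * (1 + norm z) ^ (n + m))" for z
  proof -
    define X where "X = (1 + norm z) ^ (n + m)"
    have X: "X \<ge> 1" "(1 + norm z) ^ n \<le> X" "(1 + norm z) ^ m \<le> X"
      unfolding X_def by (auto intro: power_increasing one_le_power)
    have "norm (f z) \<le> exp ((C + D) * X)"
    proof (rule order_trans[OF C(2)])
      have "C * (1 + norm z) ^ n \<le> C * X" using C X by (intro mult_left_mono) auto
      also have "\<dots> \<le> (C + D) * X" using C D X by (intro mult_right_mono) auto
      finally show "exp (C * (1 + norm z) ^ n) \<le> exp ((C + D) * X)" by simp
    qed
    moreover have "norm (g z) \<le> exp ((C + D) * X)"
    proof (rule order_trans[OF D(2)])
      have "D * (1 + norm z) ^ m \<le> D * X" using D X by (intro mult_left_mono) auto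
      also have "\<dots> \<le> (C + D) * X" using C D X by (intro mult_right_mono) auto
      finally show "exp (D * (1 + norm z) ^ m) \<le> exp ((C + D) * X)" by simp
    qed
    ultimately have "norm (f z + g z) \<le> 2 * exp ((C + D) * X)"
      using norm_triangle_ineq[of "f z" "g z"] by linarith
    \<comment> \<open>The factor 2 is absorbed by e^X because X >= 1; this is the extra 1 in the
      constant 1 + C + D.\<close>
    also have "2 \<le> exp X" using exp_ge_add_one_self[of X] X(1) by linarith
    hence "2 * exp ((C + D) * X) \<le> exp X * exp ((C + D) * X)" by (intro mult_right_mono) auto
    also have "\<dots> = exp ((1 + C + D) * X)" by (simp add: algebra_simps flip: exp_add)
    finally show ?thesis by (simp add: X_def)
  qed
  thus ?thesis unfolding finite_order_def by blast
qed

lemma norm_poly_le: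
  fixes p :: "complex poly"
  obtains C n where "C \<ge> 0" "\<And>z. norm (poly p z) \<le> C * (1 + norm z) ^ n"
proof (induction p arbitrary: thesis)
  case 0
  show ?case by (rule 0[of 0 0]) auto
next
  case (pCons a p)
  obtain C n where C: "C \<ge> 0" "\<And>z. norm (poly p z) \<le> C * (1 + norm z) ^ n"
    using pCons.IH by blast
  show ?case
  proof (rule pCons.prems)
    fix z :: complex
    have "norm (poly (pCons a p) z) \<le> norm a + norm z * norm (poly p z)"
      using norm_triangle_ineq[of a "z * poly p z"] by (simp add: norm_mult)
    also have "\<dots> \<le> norm a * (1 + norm z) ^ Suc n + (1 + norm z) * (C * (1 + norm z) ^ n)"
      using C by (intro add_mono mult_mono) (auto simp: mult_le_cancel_left1 one_le_power simp del: power_Suc)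
    finally show "norm (poly (pCons a p) z) \<le> (norm a + C) * (1 + norm z) ^ Suc n"
      by (simp add: algebra_simps)
  qed (use C in simp)
qed

lemma finite_order_poly: "finite_order (poly p)"
proof -
  obtain C n where "C \<ge> 0" "\<And>z. norm (poly p z) \<le> C * (1 + norm z) ^ n"
    using norm_poly_le[of p] by blast
  moreover have "x \<le> exp x" for x :: real
    using exp_ge_add_one_self[of x] by linarith
  ultimately show ?thesis unfolding finite_order_def by (meson order_trans)
qed

lemma finite_order_exp_poly: "finite_order (\<lambda>z. exp (poly p z))"
proof -
  obtain C n where "C \<ge> 0" "\<And>z. norm (poly p z) \<le> C * (1 + norm z) ^ n"
    using norm_poly_le[of p] by blast
  hence "norm (exp (poly p z)) \<le> exp (C * (1 + norm z) ^ n)" for z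
    by (simp add: norm_exp_eq_Re) (meson complex_Re_le_cmod order_trans)
  thus ?thesis unfolding finite_order_def by blast
qed

lemma finite_order_sum:
  "finite I \<Longrightarrow> (\<And>i. i \<in> I \<Longrightarrow> finite_order (f i)) \<Longrightarrow> finite_order (\<lambda>z. \<Sum>i\<in>I. f i z)"
proof (induction I rule: finite_induct)
  case empty
  show ?case using finite_order_poly[of 0] unfolding poly_0 sum.empty .
qed (auto intro: finite_order_add)

section \<open>Entire functions of finite order with finitely many zeros\<close>

text \<open>Borel--Caratheodory: apply the Schwarz lemma to $f / (2M - f)$.\<close>

lemma Borel_Caratheodory_half:
  assumes holf: "f holomorphic_on ball 0 (2 * r)" and "f 0 = 0" and "r > 0"
    and Re: "\<And>z. norm z < 2 * r \<Longrightarrow> Re (f z) < M"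
    and z: "norm z \<le> r"
  shows "norm (f z) \<le> 2 * M"
proof -
  have M: "M > 0" using Re[of 0] assms by simp
  define h where "h = (\<lambda>w. f (of_real (2 * r) * w) / (2 * of_real M - f (of_real (2 * r) * w)))"
  have inb: "norm (of_real (2 * r) * w) < 2 * r" if "norm w < 1" for w :: complex
    using that \<open>r > 0\<close> by (simp add: norm_mult)
  \<comment> \<open>A point of the half plane Re u < M is closer to 0 than to 2M, the mirror image
    of 0 in the boundary line. Hence u / (2M - u) lies in the unit disc.\<close>
  have less: "norm u < norm (2 * of_real M - u)" if "Re u < M" for u :: complex
  proof -
    have "(norm u)\<^sup>2 < (norm (2 * of_real M - u))\<^sup>2"
      using that M unfolding cmod_power2 by (simp add: power2_eq_square algebra_simps)
    thus ?thesis using power2_less_imp_less norm_ge_zero by blast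
  qed
  have nz: "2 * of_real M - u \<noteq> 0" if "Re u < M" for u :: complex
    using less[OF that] by auto
  have "norm (h (z / of_real (2 * r))) \<le> norm (z / of_real (2 * r))"
  proof (rule Schwarz_Lemma(1))
    have "f \<circ> (\<lambda>w. of_real (2 * r) * w) holomorphic_on ball 0 1"
      by (rule holomorphic_on_compose_gen[OF _ holf]) (use inb in \<open>auto intro!: holomorphic_intros\<close>)
    hence "(\<lambda>w. f (of_real (2 * r) * w)) holomorphic_on ball 0 1" by (simp add: o_def)
    thus "h holomorphic_on ball 0 1" unfolding h_def
      using nz Re inb by (intro holomorphic_intros) auto
    show "h 0 = 0" by (simp add: h_def assms)
    show "norm (h w) < 1" if "norm w < 1" for w
    proof -
      have "Re (f (of_real (2 * r) * w)) < M" using Re inb[OF that] by blast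
      from less[OF this] show ?thesis unfolding h_def norm_divide
        by (simp add: divide_less_eq)
    qed
    show "norm (z / of_real (2 * r)) < 1"
      using z \<open>r > 0\<close> by (simp add: norm_divide norm_mult)
  qed
  also have "\<dots> \<le> 1 / 2" using z \<open>r > 0\<close> by (simp add: norm_divide norm_mult field_simps)
  also have "h (z / of_real (2 * r)) = f z / (2 * of_real M - f z)"
    using \<open>r > 0\<close> by (simp add: h_def)
  finally have "norm (f z) / norm (2 * of_real M - f z) \<le> 1 / 2"
    by (simp add: norm_divide)
  moreover have "norm (2 * of_real M - f z) > 0"
    using nz Re[of z] z \<open>r > 0\<close> by simp
  ultimately have "2 * norm (f z) \<le> norm (2 * of_real M - f z)"
    by (simp add: field_simps)
  also have "\<dots> \<le> 2 * M + norm (f z)"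
    using norm_triangle_ineq4[of "2 * of_real M" "f z"] M by (simp add: norm_mult)
  finally show ?thesis by simp
qed

text \<open>Borel-Caratheodory upgrades the one-sided bound on the real part to polynomial growth of
  the modulus, and Liouville's theorem for polynomial growth finishes.\<close>

lemma entire_Re_bound_imp_poly:
  assumes holf: "f holomorphic_on UNIV" and C: "C \<ge> 0"
    and bound: "\<And>z. Re (f z) \<le> C * (1 + norm z) ^ n"
  obtains p where "f = poly p"
proof -
  \<comment> \<open>Normalised to vanish at 0, as the Schwarz lemma argument requires.\<close>
  define g where "g = (\<lambda>z. f z - f 0)"
  have holg: "g holomorphic_on A" for A
    unfolding g_def by (intro holomorphic_intros holomorphic_on_subset[OF holf]) auto
  \<comment> \<open>For |w| < 2|z| and |z| >= 1 we have 1 + |w| <= 3|z|, hence 3^n. The summand 1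
    makes the bound on Re (g w) strict.\<close>
  define K where "K = C * 3 ^ n + norm (f 0) + 1"
  have gb: "norm (g z) \<le> (2 * K) * norm z ^ n" if z: "1 \<le> norm z" for z
  proof -
    have "norm (g z) \<le> 2 * (K * norm z ^ n)"
    proof (rule Borel_Caratheodory_half[where f = g and z = z and r = "norm z"])
      fix w :: complex assume w: "norm w < 2 * norm z"
      have "Re (g w) \<le> C * (1 + norm w) ^ n + norm (f 0)"
        using bound[of w] abs_Re_le_cmod[of "f 0"] by (simp add: g_def)
      also have "\<dots> \<le> C * (3 * norm z) ^ n + norm (f 0)"
        using w z C by (intro add_right_mono mult_left_mono power_mono) auto
      also have "\<dots> < C * (3 * norm z) ^ n + (norm (f 0) + 1) * norm z ^ n"
      proof -
        have "(norm (f 0) + 1) * 1 \<le> (norm (f 0) + 1) * norm z ^ n"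
          using z by (intro mult_left_mono one_le_power) auto
        thus ?thesis by simp
      qed
      also have "\<dots> = K * norm z ^ n" by (simp add: K_def algebra_simps power_mult_distrib)
      finally show "Re (g w) < K * norm z ^ n" .
    qed (use z holg in \<open>auto simp: g_def\<close>)
    thus ?thesis by simp
  qed
  have g: "g z = (\<Sum>k\<le>n. (deriv ^^ k) g 0 / fact k * z ^ k)" for z
    by (rule Liouville_polynomial[OF holg gb])
  have "f z = poly ((\<Sum>k\<le>n. monom ((deriv ^^ k) g 0 / fact k) k) + [:f 0:]) z" for z
    using g[of z] by (simp add: g_def poly_sum poly_monom diff_eq_eq)
  thus ?thesis using that by blast
qed

text \<open>Serves to pass from a growth bound on f = p e^h to one on e^h: far out, dividing by p
  costs only a constant.\<close>

lemma poly_bounded_below_at_infinity: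
  fixes p :: "complex poly"
  assumes "p \<noteq> 0"
  obtains c r where "c > 0" "\<And>z. norm z \<ge> r \<Longrightarrow> norm (poly p z) \<ge> c"
proof (cases "degree p = 0")
  case True
  then obtain a where "p = [:a:]" by (meson degree_eq_zeroE)
  with assms show ?thesis by (intro that[of "norm a" 0]) auto
next
  case False
  hence "filterlim (poly p) at_infinity at_infinity"
    by (intro filterlim_poly_at_infinity) auto
  hence "\<forall>\<^sub>F z in at_infinity. norm (poly p z) \<ge> 1"
    by (simp add: filterlim_at_infinity[of 0])
  thus ?thesis using that[of 1] unfolding eventually_at_infinity by auto
qed

text \<open>Let p collect the zeros of f with multiplicity. Then f and p have the same order at
  every point, so their quotient is entire and zero-free, and it has a logarithm because the plane
  is convex.\<close>

lemma entire_finite_zeros_factorization: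
  assumes holf: "f holomorphic_on UNIV" and fin: "finite {z. f z = 0}"
  obtains p h where "p \<noteq> 0" "h holomorphic_on UNIV" "\<And>z. f z = poly p z * exp (h z)"
proof -
  define Z where "Z = {z. f z = 0}"
  \<comment> \<open>\<open>zorder\<close> is an integer; it is positive at every zero of f, so
    \<open>nat\<close> loses nothing on \<open>Z\<close>.\<close>
  define m where "m = (\<lambda>w. nat (zorder f w))"
  define p where "p = (\<Prod>w\<in>Z. [:-w, 1:] ^ m w)"
  have finZ: "finite Z" using fin by (simp add: Z_def)
  have nc: "\<exists>w\<in>UNIV. f w \<noteq> 0"
  proof (rule ccontr)
    assume "\<not> ?thesis"
    hence "{z. f z = 0} = UNIV" by auto
    thus False using fin infinite_UNIV_char_0[where 'a = complex] by simp
  qed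
  have zf: "if f z = 0 then zorder f z > 0 else zorder f z = 0" for z
    using zorder_exist_zero[OF holf open_UNIV connected_UNIV UNIV_I nc, of z] by blast
  have p0: "poly p z = 0 \<longleftrightarrow> f z = 0" for z
    using finZ zf[of z] by (auto simp: p_def poly_prod Z_def m_def)
  have zo: "zorder (poly p) z = zorder f z" for z
  proof (rule zorder_eqI)
    \<comment> \<open>The cofactor of the linear factors at z. If z is not a zero of f, then m z = 0
      and nothing is split off.\<close>
    define q where "q = (\<Prod>w\<in>Z - {z}. [:-w, 1:] ^ m w)"
    have pq: "p = [:-z, 1:] ^ m z * q"
    proof (cases "z \<in> Z")
      case True
      thus ?thesis unfolding p_def q_def by (rule prod.remove[OF finZ])
    next
      case False
      with zf[of z] have "m z = 0" by (simp add: m_def Z_def split: if_splits)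
      with False show ?thesis by (simp add: p_def q_def)
    qed
    show "open (UNIV :: complex set)" "z \<in> UNIV" "poly q holomorphic_on UNIV"
      by (auto intro!: holomorphic_intros)
    show "poly q z \<noteq> 0" using finZ by (auto simp: q_def poly_prod)
    have "zorder f z = int (m z)" using zf[of z] by (auto simp: m_def split: if_splits)
    thus "poly p w = poly q w * (w - z) powi zorder f z" for w
      by (simp add: pq)
  qed
  obtain h where h: "h holomorphic_on UNIV" "\<And>z. h z \<noteq> 0" "\<And>z. f z = h z * poly p z"
  proof (rule holomorphic_zorder_factorization[OF holf open_UNIV connected_UNIV])
    show "poly p holomorphic_on UNIV" by (auto intro!: holomorphic_intros)
    show "poly p z = 0 \<longleftrightarrow> f z = 0" for z by (rule p0)
    show "zorder (poly p) z = zorder f z" for z by (rule zo)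
  qed blast
  obtain l where l: "l holomorphic_on UNIV" "\<And>z. exp (l z) = h z"
  proof (rule holomorphic_logarithm_exists[OF convex_UNIV open_UNIV h(1)])
    show "h z \<noteq> 0" for z by (rule h(2))
  qed blast+
  show ?thesis
  proof (rule that[of p l])
    from nc obtain w where "f w \<noteq> 0" by blast
    with p0[of w] show "p \<noteq> 0" by auto
    show "f z = poly p z * exp (l z)" for z by (simp add: h(3) l(2))
  qed (rule l(1))
qed

text \<open>The case of finitely many zeros of Hadamard's factorization theorem.\<close>

lemma finite_order_finite_zeros:
  assumes holf: "f holomorphic_on UNIV" and fin: "finite {z. f z = 0}"
    and ord: "finite_order f"
  obtains p q where "\<And>z. f z = poly p z * exp (poly q z)"
proof -
  obtain p h where p: "p \<noteq> 0" and h: "h holomorphic_on UNIV"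
    and f: "\<And>z. f z = poly p z * exp (h z)"
    using entire_finite_zeros_factorization[OF holf fin] by blast
  obtain C n where C: "C \<ge> 0" "\<And>z. norm (f z) \<le> exp (C * (1 + norm z) ^ n)"
    using ord by (rule finite_orderE) blast
  obtain c r where c: "c > 0" "\<And>z. norm z \<ge> r \<Longrightarrow> norm (poly p z) \<ge> c"
    using poly_bounded_below_at_infinity[OF p] by blast
  \<comment> \<open>Inside the disc p may vanish, so the growth of f says nothing about h there;
    compactness is used instead.\<close>
  have "bounded (h ` cball 0 r)"
    using h by (intro compact_imp_bounded compact_continuous_image holomorphic_on_imp_continuous_on)
      (auto intro: holomorphic_on_subset)
  then obtain K where K: "\<And>z. norm z \<le> r \<Longrightarrow> norm (h z) \<le> K"
    unfolding bounded_iff by (metis imageI mem_cball_0)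
  \<comment> \<open>C comes from the growth of f and |ln c| from the lower bound on p, both for |z|
    > r; |K| covers the disc |z| <= r.\<close>
  define D where "D = C + \<bar>ln c\<bar> + \<bar>K\<bar>"
  have "Re (h z) \<le> D * (1 + norm z) ^ n" for z
  proof -
    have X: "(1 + norm z) ^ n \<ge> 1" by (simp add: one_le_power)
    have "Re (h z) \<le> C * (1 + norm z) ^ n + \<bar>ln c\<bar> + \<bar>K\<bar>"
    proof (cases "norm z \<le> r")
      case True
      have "0 \<le> C * (1 + norm z) ^ n" using C(1) by simp
      with K[OF True] complex_Re_le_cmod[of "h z"] show ?thesis by linarith
    next
      case False
      have "exp (ln c + Re (h z)) = c * norm (exp (h z))"
        using c(1) by (simp add: exp_add norm_exp_eq_Re)
      also have "\<dots> \<le> norm (f z)"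
        unfolding f norm_mult using c(2)[of z] False by (intro mult_right_mono) auto
      also have "\<dots> \<le> exp (C * (1 + norm z) ^ n)" by (rule C)
      finally show ?thesis by simp
    qed
    also have "\<dots> \<le> C * (1 + norm z) ^ n + \<bar>ln c\<bar> * (1 + norm z) ^ n + \<bar>K\<bar> * (1 + norm z) ^ n"
      using X by (intro add_mono) (auto simp: mult_le_cancel_left1)
    also have "\<dots> = D * (1 + norm z) ^ n" by (simp add: D_def algebra_simps)
    finally show ?thesis .
  qed
  moreover have "D \<ge> 0" using C(1) by (simp add: D_def)
  ultimately obtain q where "h = poly q"
    using entire_Re_bound_imp_poly[OF h] by blast
  with f show ?thesis using that by blast
qed

text \<open>The sum is entire of finite order. With finitely many zeros it would be a single term T
  e^S, which \<open>exp_poly_sum_eq_single\<close> rules out when two coefficients are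
  non-zero.\<close>

lemma exp_poly_infinite_zeros:
  fixes P R :: "'i \<Rightarrow> complex poly"
  assumes "finite I"
    and P: "\<And>i j. i \<in> I \<Longrightarrow> j \<in> I \<Longrightarrow> i \<noteq> j \<Longrightarrow> degree (P i - P j) > 0"
    and ij: "i \<in> I" "j \<in> I" "i \<noteq> j" and R: "R i \<noteq> 0" "R j \<noteq> 0"
  shows "infinite {z. (\<Sum>i\<in>I. poly (R i) z * exp (poly (P i) z)) = 0}"
proof
  assume fin: "finite {z. (\<Sum>i\<in>I. poly (R i) z * exp (poly (P i) z)) = 0}"
  have "(\<lambda>z. \<Sum>i\<in>I. poly (R i) z * exp (poly (P i) z)) holomorphic_on UNIV"
    by (intro holomorphic_intros)
  moreover have "finite_order (\<lambda>z. \<Sum>i\<in>I. poly (R i) z * exp (poly (P i) z))"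
    using assms(1)
    by (intro finite_order_sum finite_order_mult finite_order_poly finite_order_exp_poly)
  ultimately obtain T S where
    "\<And>z. (\<Sum>i\<in>I. poly (R i) z * exp (poly (P i) z)) = poly T z * exp (poly S z)"
    using finite_order_finite_zeros fin by blast
  from exp_poly_sum_eq_single[OF assms(1) P this ij] R show False by blast
qed

section \<open>The class \<open>Fstar\<close>\<close>

text \<open>Here B e^Q plays the role of g'. The function expands to (\<alpha> B) e^(P+Q) - k B e^Q
  - a e^0. If P + Q were not constant, the three exponents would be inequivalent modulo constants.
  If it is a constant c, the outer terms merge into one coefficient, which must vanish because the
  term with k B survives.\<close>

lemma finite_zeros_imp_degree_add_eq_0:
  fixes \<alpha> B P Q a :: "complex poly"
  assumes \<alpha>: "\<alpha> \<noteq> 0" and B: "B \<noteq> 0" and deg: "degree P > 0" "degree Q > 0"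
    and k: "k \<noteq> 0" and a: "a \<noteq> 0"
    and fin: "finite {z. (poly \<alpha> z * exp (poly P z) - k) * (poly B z * exp (poly Q z)) - poly a z = 0}"
  obtains c where "P + Q = [:c:]" "smult (exp c) (\<alpha> * B) = a"
proof -
  have deg0: "degree (P + Q) = 0"
  proof (rule ccontr)
    assume pq: "degree (P + Q) \<noteq> 0"
    \<comment> \<open>This is the exponent difference \<open>Ps 2 - Ps 0\<close>.\<close>
    have "- P - Q = - (P + Q)" by simp
    hence neg: "degree (- P - Q) = degree (P + Q)" by (simp only: degree_minus)
    define Ps where "Ps = (\<lambda>i :: nat. if i = 0 then P + Q else if i = 1 then Q else 0)"
    define Rs where "Rs = (\<lambda>i :: nat. if i = 0 then \<alpha> * B else if i = 1 then smult (- k) B else - a)"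
    have "infinite {z. (\<Sum>i\<in>{0, 1, 2 :: nat}. poly (Rs i) z * exp (poly (Ps i) z)) = 0}"
    proof (rule exp_poly_infinite_zeros[where I = "{0, 1, 2}" and P = Ps and R = Rs and i = 0 and j = 2])
      show "degree (Ps i - Ps j) > 0" if "i \<in> {0, 1, 2}" "j \<in> {0, 1, 2}" "i \<noteq> j" for i j
        using that deg pq neg by (auto simp: Ps_def)
    qed (use \<alpha> B a in \<open>auto simp: Rs_def\<close>)
    moreover have "(\<Sum>i\<in>{0, 1, 2}. poly (Rs i) z * exp (poly (Ps i) z)) =
        (poly \<alpha> z * exp (poly P z) - k) * (poly B z * exp (poly Q z)) - poly a z" for z
      by (simp add: Rs_def Ps_def exp_add algebra_simps)
    ultimately show False using fin by simp
  qed
  then obtain c where c: "P + Q = [:c:]" by (meson degree_eq_zeroE)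
  have "smult (exp c) (\<alpha> * B) - a = 0"
  proof (rule ccontr)
    assume nz: "smult (exp c) (\<alpha> * B) - a \<noteq> 0"
    define Ps where "Ps = (\<lambda>i :: nat. if i = 0 then Q else 0)"
    define Rs where "Rs = (\<lambda>i :: nat. if i = 0 then smult (- k) B else smult (exp c) (\<alpha> * B) - a)"
    have "infinite {z. (\<Sum>i\<in>{0, 1 :: nat}. poly (Rs i) z * exp (poly (Ps i) z)) = 0}"
    proof (rule exp_poly_infinite_zeros[where I = "{0, 1}" and P = Ps and R = Rs and i = 0 and j = 1])
      show "degree (Ps i - Ps j) > 0" if "i \<in> {0, 1}" "j \<in> {0, 1}" "i \<noteq> j" for i j
        using that deg by (auto simp: Ps_def)
    qed (use B k nz in \<open>auto simp: Rs_def\<close>)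
    moreover have "(\<Sum>i\<in>{0, 1}. poly (Rs i) z * exp (poly (Ps i) z)) =
        (poly \<alpha> z * exp (poly P z) - k) * (poly B z * exp (poly Q z)) - poly a z" for z
    proof -
      have "poly P z + poly Q z = c" using arg_cong[OF c, of "\<lambda>p. poly p z"] by simp
      hence "exp c = exp (poly P z) * exp (poly Q z)" by (metis exp_add)
      thus ?thesis by (simp add: Rs_def Ps_def algebra_simps)
    qed
    ultimately show False using fin by simp
  qed
  thus ?thesis using c that by simp
qed

text \<open>Since Q' = -P', equality would give \<alpha> \<beta>' - \<beta> \<alpha>' = 2 \<alpha>
  \<beta> P'. The right side is non-zero of degree at least deg \<alpha> + deg \<beta>, while
  differentiation lowers the degree on the left.\<close>

lemma cross_exp_deriv_neq:
  assumes \<alpha>: "\<alpha> \<noteq> 0" and \<beta>: "\<beta> \<noteq> 0" and P: "degree P > 0" and PQ: "P + Q = [:c:]"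
  shows "\<alpha> * exp_deriv Q \<beta> \<noteq> \<beta> * exp_deriv P \<alpha>"
proof
  assume eq: "\<alpha> * exp_deriv Q \<beta> = \<beta> * exp_deriv P \<alpha>"
  have P': "pderiv P \<noteq> 0" using P by (simp add: pderiv_eq_0_iff)
  have "Q = [:c:] - P" using PQ by (simp add: algebra_simps)
  hence "pderiv Q = - pderiv P" by (simp add: pderiv_diff)
  hence key: "\<alpha> * pderiv \<beta> - \<beta> * pderiv \<alpha> = [:2:] * (\<alpha> * \<beta> * pderiv P)"
    using eq by (simp add: exp_deriv_def algebra_simps flip: numeral_poly)
  \<comment> \<open>The second alternative covers constant q: the zero polynomial has degree 0,
    which is not below deg p + deg q when p is constant too.\<close>
  have less: "degree (p * pderiv q) < degree p + degree q \<or> p * pderiv q = 0"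
    for p q :: "complex poly"
  proof (cases "degree q = 0")
    case True
    thus ?thesis by (simp add: pderiv_eq_0_iff[THEN iffD2])
  next
    case False
    with degree_mult_le[of p "pderiv q"] have "degree (p * pderiv q) < degree p + degree q"
      unfolding degree_pderiv by linarith
    thus ?thesis ..
  qed
  have "degree ([:2:] * (\<alpha> * \<beta> * pderiv P)) \<ge> degree \<alpha> + degree \<beta>"
    using \<alpha> \<beta> P' by (simp add: degree_mult_eq)
  moreover have "[:2:] * (\<alpha> * \<beta> * pderiv P) \<noteq> 0" using \<alpha> \<beta> P' by simp
  ultimately show False
    unfolding key[symmetric]
    using less[of \<alpha> \<beta>] less[of \<beta> \<alpha>] degree_diff_le_max[of "\<alpha> * pderiv \<beta>" "\<beta> * pderiv \<alpha>"]
    by auto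
qed

theorem theoremC:
  fixes f g :: "complex \<Rightarrow> complex" and a :: "complex poly"
  assumes "f \<in> Fstar" and "g \<in> Fstar" and "a \<noteq> 0"
  shows "infinite {z. f z * deriv g z - poly a z = 0} \<or>
         infinite {z. g z * deriv f z - poly a z = 0}"
proof (rule ccontr)
  assume "\<not> ?thesis"
  hence fin: "finite {z. f z * deriv g z - poly a z = 0}" "finite {z. g z * deriv f z - poly a z = 0}"
    by auto
  obtain \<alpha> P k where f: "\<alpha> \<noteq> 0" "degree P > 0" "k \<noteq> 0" "f = (\<lambda>z. poly \<alpha> z * exp (poly P z) - k)"
    using assms(1) unfolding Fstar_def by blast
  obtain \<beta> Q l where g: "\<beta> \<noteq> 0" "degree Q > 0" "l \<noteq> 0" "g = (\<lambda>z. poly \<beta> z * exp (poly Q z) - l)"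
    using assms(2) unfolding Fstar_def by blast
  have deriv: "deriv (\<lambda>z. poly R z * exp (poly S z) - m) z = poly (exp_deriv S R) z * exp (poly S z)"
    for R S m z
    using DERIV_diff[OF has_field_derivative_poly_exp DERIV_const] by (intro DERIV_imp_deriv) simp
  have A: "exp_deriv P \<alpha> \<noteq> 0" and B: "exp_deriv Q \<beta> \<noteq> 0"
    using f g by (simp_all add: exp_deriv_eq_0_iff)
  obtain c where c: "P + Q = [:c:]" "smult (exp c) (\<alpha> * exp_deriv Q \<beta>) = a"
    using finite_zeros_imp_degree_add_eq_0[OF f(1) B f(2) g(2) f(3) assms(3)] fin(1)
    unfolding f(4) g(4) deriv by blast
  \<comment> \<open>The same argument with f and g exchanged.\<close>
  obtain d where d: "Q + P = [:d:]" "smult (exp d) (\<beta> * exp_deriv P \<alpha>) = a"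
    using finite_zeros_imp_degree_add_eq_0[OF g(1) A g(2) f(2) g(3) assms(3)] fin(2)
    unfolding f(4) g(4) deriv by blast
  \<comment> \<open>Both constants are the value of P + Q, so the non-zero factor e^c cancels when
    the two expressions for a are compared.\<close>
  have "d = c" using c(1) d(1) by (simp add: add.commute)
  hence "smult (exp c) (\<alpha> * exp_deriv Q \<beta> - \<beta> * exp_deriv P \<alpha>) = 0"
    using c(2) d(2) by (simp add: smult_diff_right)
  hence "\<alpha> * exp_deriv Q \<beta> = \<beta> * exp_deriv P \<alpha>" by simp
  with cross_exp_deriv_neq[OF f(1) g(1) f(2) c(1)] show False ..
qed

end
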